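(* Let $\bm{A}=\bm{P}-\bm{Q}$ be such that $\varrho(\bm{P}^{-1}\bm{Q})<1$. Then for any $\varepsilon>0$ satisfying $\varrho(\bm{P}^{-1}\bm{Q})+\varepsilon<1$ there is an integer $n_\varepsilon>0$ such that $$\kappa(\bm{\mathcal{P}}_n^{-1}\bm{A})\le\frac{1+(\varrho(\bm{P}^{-1}\bm{Q})+\varepsilon)^n}{1-(\varrho(\bm{P}^{-1}\bm{Q})+\varepsilon)^n},\qquad n\ge n_\varepsilon,$$ where $\kappa(\bm{M})=\|\bm{M}\|\,\|\bm{M}^{-1}\|$ is the condition number with respect to the norm $\|\cdot\|$ and $\bm{\mathcal{P}}_n$ is defined by $$\bm{\mathcal{P}}_n^{-1}=\left(\bm{I}+\bm{P}^{-1}\bm{Q}+(\bm{P}^{-1}\bm{Q})^2+\cdots+(\bm{P}^{-1}\bm{Q})^{n-1}\right)\bm{P}^{-1}.$$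
   Context: $\bm{A},\bm{P},\bm{Q}$ are complex $N\times N$ matrices, $\bm{P}^{-1}$ is the inverse of $\bm{P}$, and $\bm{I}$ is the identity matrix. $\varrho(\cdot)$ denotes the spectral radius, and $\|\cdot\|$ is a matrix norm.
   Formalization: The matrix norm is taken to be submultiplicative with ‖I‖ = 1 (as for every induced norm); without this the claim fails, e.g. for the Frobenius norm with N ≥ 2, P = I and Q = 0, where κ(I) = N while the bound tends to 1. *)

theory Defs
  imports "Jordan_Normal_Form.Spectral_Radius" "Jordan_Normal_Form.Gauss_Jordan_Elimination"
begin

text \<open>Total version of the library's \<^const>\<open>mat_inverse\<close>; it carries no information
  when the argument is singular.\<close>

definition mat_inv :: "complex mat \<Rightarrow> complex mat" where
  "mat_inv A = the (mat_inverse A)"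

lemma mat_inv:
  assumes A: "A \<in> carrier_mat n n" and inv: "invertible_mat A"
  shows "mat_inv A \<in> carrier_mat n n" "A * mat_inv A = 1\<^sub>m n" "mat_inv A * A = 1\<^sub>m n"
proof -
  from inv A obtain B where B: "A * B = 1\<^sub>m n" "B * A = 1\<^sub>m (dim_row B)"
    unfolding invertible_mat_def inverts_mat_def by auto
  have "dim_col B = n" using arg_cong[OF B(1), of dim_col] by simp
  moreover have "dim_row B = n" using arg_cong[OF B(2), of dim_col] A by simp
  ultimately have "B \<in> carrier_mat n n" by auto
  with A B have "A \<in> Units (ring_mat TYPE(complex) n ())"
    by (auto simp: Units_def ring_mat_simps intro!: bexI[of _ B])
  then obtain C where C: "mat_inverse A = Some C"
    using mat_inverse(1)[OF A, where b = "()"] by (cases "mat_inverse A") auto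
  show "mat_inv A \<in> carrier_mat n n" "A * mat_inv A = 1\<^sub>m n" "mat_inv A * A = 1\<^sub>m n"
    using mat_inverse(2)[OF A C] C by (auto simp: mat_inv_def)
qed

text \<open>A matrix norm is submultiplicative. The normalisation \<open>nu (1\<^sub>m N) = 1\<close>, which holds for
  norms induced by a vector norm but not, e.g., for the Frobenius norm, is not part of the
  definition.\<close>

definition matrix_norm :: "nat \<Rightarrow> (complex mat \<Rightarrow> real) \<Rightarrow> bool" where
  "matrix_norm N nu \<longleftrightarrow>
     (\<forall>A \<in> carrier_mat N N. 0 \<le> nu A \<and> (nu A = 0 \<longleftrightarrow> A = 0\<^sub>m N N)) \<and>
     (\<forall>c. \<forall>A \<in> carrier_mat N N. nu (c \<cdot>\<^sub>m A) = cmod c * nu A) \<and>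
     (\<forall>A \<in> carrier_mat N N. \<forall>B \<in> carrier_mat N N. nu (A + B) \<le> nu A + nu B) \<and>
     (\<forall>A \<in> carrier_mat N N. \<forall>B \<in> carrier_mat N N. nu (A * B) \<le> nu A * nu B)"

definition cond_number :: "(complex mat \<Rightarrow> real) \<Rightarrow> complex mat \<Rightarrow> real" where
  "cond_number nu M = nu M * nu (mat_inv M)"

definition neumann_inv :: "complex mat \<Rightarrow> complex mat \<Rightarrow> nat \<Rightarrow> complex mat" where
  "neumann_inv P Q n =
     finsum (module_mat TYPE(complex) (dim_row P) (dim_row P))
       (\<lambda>k. (mat_inv P * Q) ^\<^sub>m k) {..<n} * mat_inv P"

text \<open>The matrix whose inverse is \<open>neumann_inv P Q n\<close>, provided the latter is nonsingular.\<close>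

definition neumann_precond :: "complex mat \<Rightarrow> complex mat \<Rightarrow> nat \<Rightarrow> complex mat" where
  "neumann_precond P Q n = mat_inv (neumann_inv P Q n)"

end

theory Submission
  imports Defs
begin

text \<open>
  Write \<open>B = P\<^sup>-\<^sup>1 Q\<close>, so that \<open>A = P (I - B)\<close>. The factor \<open>I + B + \<dots> + B\<^sup>n\<^sup>-\<^sup>1\<close> in
  \<open>neumann_inv P Q n\<close> is a truncated Neumann series for \<open>(I - B)\<^sup>-\<^sup>1\<close>; multiplied by
  \<open>P\<^sup>-\<^sup>1 A = I - B\<close> it telescopes, and the preconditioned matrix is exactly \<open>I - B\<^sup>n\<close>
  (\<open>neumann_inv_mult\<close>). Everything therefore depends on how small \<open>B\<^sup>n\<close> is.

  By the upper half of Gelfand's formula, \<open>nu (B\<^sup>n) \<le> t = (\<rho> + \<epsilon>)\<^sup>n\<close> for all large \<open>n\<close>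
  (\<open>matrix_norm_pow_le_eventually\<close>). It comes from the boundedness of the powers of a matrix of
  spectral radius less than 1, a consequence of the Jordan normal form, applied to \<open>B / s\<close> with
  \<open>\<rho> < s < \<rho> + \<epsilon>\<close>: the powers of \<open>B\<close> grow at most like a constant times \<open>s\<^sup>n\<close>, and the geometric
  factor \<open>(s / (\<rho> + \<epsilon>))\<^sup>n\<close> eventually absorbs the constant.

  If \<open>t < 1\<close>, then \<open>I - B\<^sup>n\<close> has an inverse of norm at most \<open>1 / (1 - t)\<close>
  (\<open>one_minus_mat_right_inverse\<close>), while its own norm is at most \<open>1 + t\<close>; the product of the two
  bounds is the claim. Invertibility of \<open>I - B\<^sup>n\<close> also yields that of \<open>neumann_inv P Q n\<close>: if
  \<open>Y\<close> is a right inverse of the product \<open>neumann_inv P Q n * A\<close>, then \<open>A * Y\<close> is one of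
  \<open>neumann_inv P Q n\<close>, and for square matrices one-sided inverses are two-sided.
\<close>

section \<open>Matrix norms and inverses\<close>

lemma matrix_normD:
  assumes "matrix_norm N nu"
  shows matrix_norm_nonneg: "A \<in> carrier_mat N N \<Longrightarrow> 0 \<le> nu A"
    and matrix_norm_eq_0: "A \<in> carrier_mat N N \<Longrightarrow> nu A = 0 \<longleftrightarrow> A = 0\<^sub>m N N"
    and matrix_norm_smult: "A \<in> carrier_mat N N \<Longrightarrow> nu (c \<cdot>\<^sub>m A) = cmod c * nu A"
    and matrix_norm_add: "A \<in> carrier_mat N N \<Longrightarrow> B \<in> carrier_mat N N \<Longrightarrow> nu (A + B) \<le> nu A + nu B"
    and matrix_norm_mult: "A \<in> carrier_mat N N \<Longrightarrow> B \<in> carrier_mat N N \<Longrightarrow> nu (A * B) \<le> nu A * nu B"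
  using assms by (auto simp: matrix_norm_def)

lemma matrix_norm_diff:
  assumes nu: "matrix_norm N nu" and A: "A \<in> carrier_mat N N" and B: "B \<in> carrier_mat N N"
  shows "nu (A - B) \<le> nu A + nu B"
proof -
  have "A - B = A + (- 1) \<cdot>\<^sub>m B"
    using A B by (intro eq_matI) auto
  moreover have "nu ((- 1) \<cdot>\<^sub>m B) = nu B"
    by (simp add: matrix_norm_smult[OF nu B])
  ultimately show ?thesis
    using matrix_norm_add[OF nu A, of "(- 1) \<cdot>\<^sub>m B"] B by simp
qed

lemma mat_inv_eqI:
  assumes A: "A \<in> carrier_mat n n" and B: "B \<in> carrier_mat n n" and AB: "A * B = 1\<^sub>m n"
  shows "invertible_mat A" and "mat_inv A = B"
proof -
  have BA: "B * A = 1\<^sub>m n"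
    by (rule mat_mult_left_right_inverse[OF A B AB])
  show inv: "invertible_mat A"
    unfolding invertible_mat_def inverts_mat_def using A B AB BA by auto
  note M = mat_inv[OF A inv]
  have "mat_inv A = (B * A) * mat_inv A"
    using M(1) by (simp add: BA)
  also have "\<dots> = B * (A * mat_inv A)"
    by (rule assoc_mult_mat[OF B A M(1)])
  also have "\<dots> = B"
    using B by (simp add: M(2))
  finally show "mat_inv A = B" .
qed

section \<open>The truncated Neumann series\<close>

text \<open>The geometric sum. Membership of the sum in the carrier is part of the induction because the
  distributive law used in the step requires it.\<close>

lemma neumann_sum_telescope:
  fixes B :: "'a :: comm_ring_1 mat"
  assumes B: "B \<in> carrier_mat N N"
  shows "finsum (module_mat TYPE('a) N N) (\<lambda>k. B ^\<^sub>m k) {..<n} \<in> carrier_mat N N \<and>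
    finsum (module_mat TYPE('a) N N) (\<lambda>k. B ^\<^sub>m k) {..<n} * (1\<^sub>m N - B) = 1\<^sub>m N - B ^\<^sub>m n"
proof (induction n)
  case 0
  interpret abelian_group "module_mat TYPE('a) N N" by (rule abelian_group_mat)
  show ?case using B by (auto simp: module_mat_simps)
next
  case (Suc n)
  interpret abelian_group "module_mat TYPE('a) N N" by (rule abelian_group_mat)
  let ?S = "\<lambda>n. finsum (module_mat TYPE('a) N N) (\<lambda>k. B ^\<^sub>m k) {..<n}"
  have S: "?S n \<in> carrier_mat N N" and IH: "?S n * (1\<^sub>m N - B) = 1\<^sub>m N - B ^\<^sub>m n"
    using Suc by auto
  have Bn: "B ^\<^sub>m n \<in> carrier_mat N N" and D: "1\<^sub>m N - B \<in> carrier_mat N N"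
    using B by auto
  have ins: "?S (Suc n) = B ^\<^sub>m n + ?S n"
    unfolding lessThan_Suc
    by (subst finsum_insert) (use B in \<open>auto simp: module_mat_simps\<close>)
  have "?S (Suc n) * (1\<^sub>m N - B) = B ^\<^sub>m n * (1\<^sub>m N - B) + ?S n * (1\<^sub>m N - B)"
    unfolding ins by (rule add_mult_distrib_mat[OF Bn S D])
  also have "B ^\<^sub>m n * (1\<^sub>m N - B) = B ^\<^sub>m n - B ^\<^sub>m Suc n"
    using Bn B by (simp add: mult_minus_distrib_mat[OF Bn _ B])
  also have "B ^\<^sub>m n - B ^\<^sub>m Suc n + ?S n * (1\<^sub>m N - B) = 1\<^sub>m N - B ^\<^sub>m Suc n"
    unfolding IH using Bn B by (intro eq_matI) auto
  finally show ?case
    using S Bn unfolding ins by auto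
qed

lemma neumann_inv_mult:
  assumes P: "P \<in> carrier_mat N N" and Q: "Q \<in> carrier_mat N N" and inv: "invertible_mat P"
  shows "neumann_inv P Q n \<in> carrier_mat N N"
    and "neumann_inv P Q n * (P - Q) = 1\<^sub>m N - (mat_inv P * Q) ^\<^sub>m n"
proof -
  note R = mat_inv[OF P inv]
  define S where "S = finsum (module_mat TYPE(complex) N N) (\<lambda>k. (mat_inv P * Q) ^\<^sub>m k) {..<n}"
  have B: "mat_inv P * Q \<in> carrier_mat N N"
    using R(1) Q by simp
  from neumann_sum_telescope[OF B, of n]
  have S: "S \<in> carrier_mat N N" and tel: "S * (1\<^sub>m N - mat_inv P * Q) = 1\<^sub>m N - (mat_inv P * Q) ^\<^sub>m n"
    unfolding S_def by auto
  have C: "neumann_inv P Q n = S * mat_inv P"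
    using P by (simp add: neumann_inv_def S_def)
  show "neumann_inv P Q n \<in> carrier_mat N N"
    unfolding C using S R(1) by simp
  have "neumann_inv P Q n * (P - Q) = S * (mat_inv P * (P - Q))"
    unfolding C using P Q by (intro assoc_mult_mat[OF S R(1)]) auto
  also have "mat_inv P * (P - Q) = 1\<^sub>m N - mat_inv P * Q"
    by (simp add: mult_minus_distrib_mat[OF R(1) P Q] R(3))
  finally show "neumann_inv P Q n * (P - Q) = 1\<^sub>m N - (mat_inv P * Q) ^\<^sub>m n"
    by (simp only: tel)
qed

section \<open>Small perturbations of the identity\<close>

text \<open>Since \<open>nu\<close> measures matrices only, the fixed vector is turned into the matrix \<open>V\<close> all of whose
  columns equal it. Then \<open>X V = V \<noteq> 0\<close>, and submultiplicativity allows \<open>nu V\<close> to be cancelled.\<close>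

lemma matrix_norm_ge_1_if_fixed_vec:
  assumes nu: "matrix_norm N nu" and X: "X \<in> carrier_mat N N"
    and v: "v \<in> carrier_vec N" "v \<noteq> 0\<^sub>v N" "X *\<^sub>v v = v"
  shows "1 \<le> nu X"
proof -
  define V where "V = mat N N (\<lambda>(i, j). v $ i)"
  have V: "V \<in> carrier_mat N N"
    by (simp add: V_def)
  have "col V j = v" if "j < N" for j
    using v(1) that by (intro eq_vecI) (auto simp: V_def)
  then have XV: "X * V = V"
    using X V v(1,3) by (intro eq_matI) (auto simp: V_def simp flip: index_mult_mat_vec)
  obtain i where "i < N" "v $ i \<noteq> 0"
    using v(1,2) by (metis carrier_vecD eq_vecI index_zero_vec)
  then have "V \<noteq> 0\<^sub>m N N"
    by (metis V_def index_mat(1) index_zero_mat(1) case_prod_conv)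
  then have "0 < nu V"
    using matrix_norm_nonneg[OF nu V] matrix_norm_eq_0[OF nu V] by linarith
  moreover have "nu V \<le> nu X * nu V"
    using matrix_norm_mult[OF nu X V] by (simp only: XV)
  ultimately show ?thesis
    by simp
qed

text \<open>A kernel vector of \<open>I - X\<close> would be fixed by \<open>X\<close>, which the previous lemma rules out. The
  inverse \<open>Y\<close> satisfies \<open>Y = I + X Y\<close>, whence \<open>nu Y \<le> 1 + t * nu Y\<close>, which is
  solved for \<open>nu Y\<close>.\<close>

lemma one_minus_mat_right_inverse:
  assumes nu: "matrix_norm N nu" and one: "nu (1\<^sub>m N) = 1"
    and X: "X \<in> carrier_mat N N" and t: "nu X \<le> t" "t < 1"
  obtains Y where "Y \<in> carrier_mat N N" "(1\<^sub>m N - X) * Y = 1\<^sub>m N" "nu Y \<le> 1 / (1 - t)"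
proof -
  let ?M = "1\<^sub>m N - X"
  have M: "?M \<in> carrier_mat N N"
    using X by auto
  have "det ?M \<noteq> 0"
  proof
    assume "det ?M = 0"
    then obtain v where v: "v \<in> carrier_vec N" "v \<noteq> 0\<^sub>v N" and 0: "?M *\<^sub>v v = 0\<^sub>v N"
      unfolding det_0_iff_vec_prod_zero_field[OF M] by auto
    have diff: "v - X *\<^sub>v v = 0\<^sub>v N"
      using 0 X v(1) by (simp add: minus_mult_distrib_mat_vec[of _ N N])
    have "X *\<^sub>v v = v"
    proof (rule eq_vecI)
      fix i assume "i < dim_vec v"
      then show "(X *\<^sub>v v) $ i = v $ i"
        using arg_cong[OF diff, of "\<lambda>w. w $ i"] X v(1) by auto
    qed (use X v(1) in auto)
    from matrix_norm_ge_1_if_fixed_vec[OF nu X v this] t show False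
      by simp
  qed
  from det_non_zero_imp_unit[OF M this, of "()"]
  obtain Y where Y: "Y \<in> carrier_mat N N" and MY: "?M * Y = 1\<^sub>m N"
    by (auto simp: Units_def ring_mat_simps)
  have XY: "X * Y \<in> carrier_mat N N"
    using X Y by simp
  have "Y - X * Y = 1\<^sub>m N"
    using MY X Y by (simp add: minus_mult_distrib_mat[of _ N N])
  (* A variable Z in place of X * Y keeps the entries of the product from being expanded. *)
  moreover have "Y = (Y - Z) + Z" if "Z \<in> carrier_mat N N" for Z
    using Y that by (intro eq_matI) auto
  note this[OF XY]
  ultimately have "nu Y \<le> 1 + nu (X * Y)"
    using matrix_norm_add[OF nu one_carrier_mat XY] one by simp
  also have "nu (X * Y) \<le> nu X * nu Y"
    by (rule matrix_norm_mult[OF nu X Y])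
  also have "nu X * nu Y \<le> t * nu Y"
    by (intro mult_right_mono t matrix_norm_nonneg[OF nu Y])
  finally have "nu Y \<le> 1 / (1 - t)"
    using t(2) by (simp add: field_simps)
  with Y MY show ?thesis
    using that by blast
qed

section \<open>Growth of matrix powers\<close>

text \<open>Half of the equivalence of norms in finite dimension. It transfers entrywise estimates
  (\<open>norm_bound\<close>), in which the growth of powers is known, to \<open>nu\<close>. The constant is the sum of
  the norms of the matrix units.\<close>

lemma matrix_norm_le_entries:
  assumes nu: "matrix_norm N nu"
  obtains K where
    "\<And>X b. X \<in> carrier_mat N N \<Longrightarrow> norm_bound X b \<Longrightarrow> nu X \<le> K * b"
proof
  define E :: "nat \<times> nat \<Rightarrow> complex mat" where
    "E p = mat N N (\<lambda>q. if q = p then 1 else 0)" for p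
  have E: "E p \<in> carrier_mat N N" for p
    by (simp add: E_def)
  let ?I = "{..<N} \<times> {..<N}"
  fix X :: "complex mat" and b
  assume X: "X \<in> carrier_mat N N" and b: "norm_bound X b"
  (* R F keeps only the entries of X with position in F; adding the positions one at a time replaces
     a finite sum of matrices by an induction on F. *)
  define R where "R F = mat N N (\<lambda>q. if q \<in> F then X $$ q else 0)" for F
  have R: "R F \<in> carrier_mat N N" for F
    by (simp add: R_def)
  have part: "nu (R F) \<le> (\<Sum>p\<in>F. cmod (X $$ p) * nu (E p))" if "finite F" for F
    using that
  proof (induction F)
    case empty
    have "R {} = 0\<^sub>m N N"
      by (intro eq_matI) (auto simp: R_def)
    then show ?case
      using matrix_norm_eq_0[OF nu, of "0\<^sub>m N N"] by simp
  next
    case (insert p F)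
    have "R (insert p F) = X $$ p \<cdot>\<^sub>m E p + R F"
      using insert.hyps by (intro eq_matI) (auto simp: R_def E_def)
    then have "nu (R (insert p F)) \<le> cmod (X $$ p) * nu (E p) + nu (R F)"
      using matrix_norm_add[OF nu, of "X $$ p \<cdot>\<^sub>m E p" "R F"] E R
      by (simp add: matrix_norm_smult[OF nu])
    also note insert.IH
    finally show ?case
      by (simp add: sum.insert[OF insert.hyps])
  qed
  have "R ?I = X"
    using X by (intro eq_matI) (auto simp: R_def)
  then have "nu X \<le> (\<Sum>p\<in>?I. cmod (X $$ p) * nu (E p))"
    using part[of ?I] by simp
  also have "\<dots> \<le> (\<Sum>p\<in>?I. b * nu (E p))"
  proof (intro sum_mono mult_right_mono matrix_norm_nonneg[OF nu E])
    fix p assume "p \<in> ?I"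
    then show "cmod (X $$ p) \<le> b"
      using b X by (auto simp: norm_bound_def)
  qed
  also have "\<dots> = (\<Sum>p\<in>?I. nu (E p)) * b"
    by (simp add: sum_distrib_left mult.commute)
  finally show "nu X \<le> (\<Sum>p\<in>?I. nu (E p)) * b" .
qed

lemma smult_pow_mat:
  fixes B :: "'a :: comm_ring_1 mat"
  assumes B: "B \<in> carrier_mat N N"
  shows "(c \<cdot>\<^sub>m B) ^\<^sub>m k = c ^ k \<cdot>\<^sub>m B ^\<^sub>m k"
proof (induction k)
  case 0
  show ?case using B by (intro eq_matI) auto
next
  case (Suc k)
  have Bk: "B ^\<^sub>m k \<in> carrier_mat N N"
    using B by simp
  have "c ^ k \<cdot>\<^sub>m B ^\<^sub>m k * (c \<cdot>\<^sub>m B) = c \<cdot>\<^sub>m (c ^ k \<cdot>\<^sub>m (B ^\<^sub>m k * B))"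
    using B Bk by (simp add: mult_smult_distrib[of _ N N _ N] mult_smult_assoc_mat[of _ N N _ N])
  then show ?case
    using Suc B Bk by (auto intro!: eq_matI)
qed

lemma spectral_radius_smult_le:
  assumes B: "B \<in> carrier_mat N N" and N: "N > 0" and c: "c \<noteq> 0"
  shows "spectral_radius (c \<cdot>\<^sub>m B) \<le> cmod c * spectral_radius B"
proof -
  have cB: "c \<cdot>\<^sub>m B \<in> carrier_mat N N"
    using B by simp
  obtain k where k: "spectral_radius (c \<cdot>\<^sub>m B) = cmod k" "k \<in> spectrum (c \<cdot>\<^sub>m B)"
    using spectral_radius_mem_max(1)[OF cB N] by auto
  then obtain v where v: "v \<in> carrier_vec N" "v \<noteq> 0\<^sub>v N" and ev: "c \<cdot>\<^sub>m B *\<^sub>v v = k \<cdot>\<^sub>v v"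
    using B by (auto simp: spectrum_def eigenvalue_def eigenvector_def)
  have "c \<cdot>\<^sub>m B *\<^sub>v v = c \<cdot>\<^sub>v (B *\<^sub>v v)"
    using B v(1) by (intro eq_vecI) auto
  then have "c \<cdot>\<^sub>v (B *\<^sub>v v) = k \<cdot>\<^sub>v v"
    by (simp only: ev)
  then have "(1 / c) \<cdot>\<^sub>v (c \<cdot>\<^sub>v (B *\<^sub>v v)) = (1 / c) \<cdot>\<^sub>v (k \<cdot>\<^sub>v v)"
    by (rule arg_cong)
  then have "B *\<^sub>v v = (k / c) \<cdot>\<^sub>v v"
    using c by (simp add: smult_smult_assoc)
  then have "k / c \<in> spectrum B"
    using B v by (auto simp: spectrum_def eigenvalue_def eigenvector_def)
  then have "cmod (k / c) \<le> spectral_radius B"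
    by (intro spectral_radius_mem_max(2)[OF B N] imageI)
  then show ?thesis
    using c by (simp add: k(1) norm_divide field_simps)
qed

text \<open>The upper half of Gelfand's formula. The strict inequality leaves room for an intermediate
  rate \<open>s\<close>.\<close>

lemma matrix_norm_pow_le_eventually:
  assumes nu: "matrix_norm N nu" and B: "B \<in> carrier_mat N N" and N: "N > 0"
    and r: "spectral_radius B < r"
  shows "\<forall>\<^sub>F n in sequentially. nu (B ^\<^sub>m n) \<le> r ^ n"
proof -
  have \<rho>0: "0 \<le> spectral_radius B"
    using spectral_radius_mem_max(1)[OF B N] by auto
  obtain s where s: "spectral_radius B < s" "s < r"
    using dense[OF r] by blast
  have s0: "0 < s" and r0: "0 < r"
    using \<rho>0 s by auto
  let ?c = "complex_of_real (1 / s)"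
  have "spectral_radius (?c \<cdot>\<^sub>m B) \<le> cmod ?c * spectral_radius B"
    by (rule spectral_radius_smult_le[OF B N]) (use s0 in auto)
  also have "\<dots> < 1"
    using s s0 by (simp add: norm_divide)
  finally obtain b where b: "norm_bound ((?c \<cdot>\<^sub>m B) ^\<^sub>m n) b" for n
    using spectral_radius_jnf_norm_bound_less_1_upper_triangular[of "?c \<cdot>\<^sub>m B" N] B by auto
  obtain K where K: "\<And>X b. X \<in> carrier_mat N N \<Longrightarrow> norm_bound X b \<Longrightarrow> nu X \<le> K * b"
    using matrix_norm_le_entries[OF nu] by metis
  have bound: "nu (B ^\<^sub>m n) \<le> K * b * s ^ n" for n
  proof -
    have Bn: "B ^\<^sub>m n \<in> carrier_mat N N"
      using B by simp
    have "nu (?c ^ n \<cdot>\<^sub>m B ^\<^sub>m n) \<le> K * b"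
      using K[OF _ b[of n]] B Bn by (simp add: smult_pow_mat[OF B])
    then show ?thesis
      using s0 by (simp add: matrix_norm_smult[OF nu Bn] norm_power norm_divide field_simps)
  qed
  have "(\<lambda>n. K * b * (s / r) ^ n) \<longlonglongrightarrow> K * b * 0"
    by (intro tendsto_mult_left LIMSEQ_power_zero) (use s s0 in auto)
  then have "\<forall>\<^sub>F n in sequentially. K * b * (s / r) ^ n < 1"
    by (auto dest: order_tendstoD(2)[where a = 1])
  then show ?thesis
  proof eventually_elim
    case (elim n)
    have "K * b * s ^ n \<le> r ^ n"
      using elim r0 by (simp add: power_divide field_simps)
    with bound[of n] show ?case
      by linarith
  qed
qed

theorem lemma2p1:
  fixes A P Q :: "complex mat" and N :: nat
    and nu :: "complex mat \<Rightarrow> real" and \<epsilon> :: real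
  assumes "N > 0"
    and "P \<in> carrier_mat N N" and "Q \<in> carrier_mat N N"
    and "invertible_mat P"
    and "A = P - Q"
    and "matrix_norm N nu" and "nu (1\<^sub>m N) = 1"
    and "spectral_radius (mat_inv P * Q) < 1"
    and "\<epsilon> > 0" and "spectral_radius (mat_inv P * Q) + \<epsilon> < 1"
  shows "\<exists>n\<^sub>\<epsilon>::nat. n\<^sub>\<epsilon> > 0 \<and> (\<forall>n \<ge> n\<^sub>\<epsilon>.
      invertible_mat (neumann_precond P Q n) \<and>
      mat_inv (neumann_precond P Q n) = neumann_inv P Q n \<and>
      invertible_mat (mat_inv (neumann_precond P Q n) * A) \<and>
      cond_number nu (mat_inv (neumann_precond P Q n) * A)
        \<le> (1 + (spectral_radius (mat_inv P * Q) + \<epsilon>) ^ n) /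
          (1 - (spectral_radius (mat_inv P * Q) + \<epsilon>) ^ n))"
proof -
  note P = assms(2) and Q = assms(3) and inv = assms(4) and nu = assms(6) and one = assms(7)
  define B where "B = mat_inv P * Q"
  define r where "r = spectral_radius B + \<epsilon>"
  have B: "B \<in> carrier_mat N N"
    using mat_inv(1)[OF P inv] Q by (simp add: B_def)
  have A: "A \<in> carrier_mat N N"
    using P Q assms(5) by auto
  have "0 \<le> spectral_radius B"
    using spectral_radius_mem_max(1)[OF B assms(1)] by auto
  then have r: "0 < r" "r < 1" "spectral_radius B < r"
    using assms(9,10) by (auto simp: r_def B_def)
  obtain n0 where n0: "\<And>n. n \<ge> n0 \<Longrightarrow> nu (B ^\<^sub>m n) \<le> r ^ n"
    using matrix_norm_pow_le_eventually[OF nu B assms(1) r(3)]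
    by (auto simp: eventually_sequentially)
  (* Suc makes n positive, so that r ^ n < 1. *)
  have concl: "invertible_mat (neumann_precond P Q n) \<and>
      mat_inv (neumann_precond P Q n) = neumann_inv P Q n \<and>
      invertible_mat (mat_inv (neumann_precond P Q n) * A) \<and>
      cond_number nu (mat_inv (neumann_precond P Q n) * A) \<le> (1 + r ^ n) / (1 - r ^ n)"
    if n: "n \<ge> Suc n0" for n
  proof -
    let ?C = "neumann_inv P Q n" and ?M = "1\<^sub>m N - B ^\<^sub>m n"
    have Bn: "B ^\<^sub>m n \<in> carrier_mat N N" and M: "?M \<in> carrier_mat N N"
      using B by auto
    have C: "?C \<in> carrier_mat N N" and CA: "?C * A = ?M"
      using neumann_inv_mult[OF P Q inv, of n] assms(5) by (simp_all add: B_def)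
    have nB: "nu (B ^\<^sub>m n) \<le> r ^ n"
      using n0 n by simp
    have rn: "r ^ n < 1"
      using r n by (intro power_less_one_iff[THEN iffD2]) auto
    obtain Y where Y: "Y \<in> carrier_mat N N" and MY: "?M * Y = 1\<^sub>m N" and nY: "nu Y \<le> 1 / (1 - r ^ n)"
      using one_minus_mat_right_inverse[OF nu one Bn nB rn] by blast
    have AY: "A * Y \<in> carrier_mat N N"
      using A Y by simp
    have CAY: "?C * (A * Y) = 1\<^sub>m N"
      using MY assoc_mult_mat[OF C A Y] by (simp only: CA)
    have precond: "neumann_precond P Q n = A * Y"
      unfolding neumann_precond_def by (rule mat_inv_eqI(2)[OF C AY CAY])
    have AYC: "A * Y * ?C = 1\<^sub>m N"
      by (rule mat_mult_left_right_inverse[OF C AY CAY])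
    note inv_precond = mat_inv_eqI[OF AY C AYC, folded precond]
    note inv_M = mat_inv_eqI[OF M Y MY]
    have "nu ?M \<le> 1 + r ^ n"
      using matrix_norm_diff[OF nu one_carrier_mat Bn] nB one by simp
    then have "nu ?M * nu Y \<le> (1 + r ^ n) * (1 / (1 - r ^ n))"
      using r by (intro mult_mono nY matrix_norm_nonneg[OF nu Y]) auto
    then have "cond_number nu ?M \<le> (1 + r ^ n) / (1 - r ^ n)"
      by (simp add: cond_number_def inv_M(2))
    then show ?thesis
      using inv_precond inv_M(1) by (simp add: CA)
  qed
  then show ?thesis
    unfolding B_def[symmetric] r_def[symmetric] by blast
qed

end
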